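(* Let $n\geq 3$. Then: (1) the set $S(n)$ is finite (as a set of isomorphism classes of rings); (2) if $R\in S(n)$, then $R$ is finite and has characteristic $p$ for some prime $p<n$; (3) a unital ring $T$ has $\sigma(T)=n$ if and only if $T$ has a quotient (by a two-sided ideal) in $S(n)$ and has no quotient in $S(m)$ for any $3\leq m<n$.
   Context: Rings are associative; subrings are not required to contain the multiplicative identity, nor any identity. A ring $R$ is coverable if it is the union of proper subrings; such a collection of subrings is a cover. The covering number $\sigma(R)$ is the minimal number of proper subrings whose union is $R$, with $\sigma(R)=\infty$ if $R$ is not coverable or has no finite cover (in particular $\sigma$ of the zero ring is $\infty$). For $n\geq 3$, $S(n)$ is the collection of isomorphism classes of unital rings $R$ such that $\sigma(R)=n$ and $\sigma(R/I)>n$ for every proper quotient $R/I$, i.e. for every nonzero two-sided ideal $I$ of $R$. *)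

theory Defs
  imports
    "HOL-Algebra.QuotRing"
    "HOL-Computational_Algebra.Primes"
    "HOL-Library.Extended_Nat"
begin

text \<open>
  A ring is a HOL-Algebra record satisfying \<^locale>\<open>ring\<close>, so it is associative and unital;
  the zero ring is allowed. The library's subring locale requires the identity to be a member,
  whereas here a subring need not contain any identity.
\<close>

definition subrng :: "'a set \<Rightarrow> ('a, 'b) ring_scheme \<Rightarrow> bool" where
  "subrng H R \<longleftrightarrow>
     additive_subgroup H R \<and> (\<forall>x\<in>H. \<forall>y\<in>H. x \<otimes>\<^bsub>R\<^esub> y \<in> H)"

definition ring_cover :: "'a set set \<Rightarrow> ('a, 'b) ring_scheme \<Rightarrow> bool" where
  "ring_cover C R \<longleftrightarrow>
     (\<forall>H\<in>C. subrng H R \<and> H \<noteq> carrier R) \<and> \<Union>C = carrier R"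

text \<open>The infimum of the empty set in \<^typ>\<open>enat\<close> is \<open>\<infinity>\<close>, which is the value of
  the covering number when there is no finite cover.\<close>

definition covering_number :: "('a, 'b) ring_scheme \<Rightarrow> enat" where
  "covering_number R = Inf {enat (card C) | C. finite C \<and> ring_cover C R}"

definition ring_characteristic :: "('a, 'b) ring_scheme \<Rightarrow> nat" where
  "ring_characteristic R =
     (if \<exists>k::nat. k > 0 \<and> [k] \<cdot>\<^bsub>R\<^esub> \<one>\<^bsub>R\<^esub> = \<zero>\<^bsub>R\<^esub>
      then LEAST k::nat. k > 0 \<and> [k] \<cdot>\<^bsub>R\<^esub> \<one>\<^bsub>R\<^esub> = \<zero>\<^bsub>R\<^esub>
      else 0)"

text \<open>The rings with carrier in a given type whose isomorphism class belongs to \<open>S(n)\<close>;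
  the collection of isomorphism classes itself is \<open>S n // ring_iso_rel\<close>. The
  relation is restricted to rings because \<open>\<simeq>\<close> constrains neither the zero of a record
  nor its operations outside the carrier.\<close>

definition S :: "nat \<Rightarrow> 'a ring set" where
  "S n = {R. ring R \<and> covering_number R = enat n \<and>
             (\<forall>I. ideal I R \<and> I \<noteq> {\<zero>\<^bsub>R\<^esub>} \<longrightarrow> covering_number (R Quot I) > enat n)}"

definition ring_iso_rel :: "('a ring \<times> 'a ring) set" where
  "ring_iso_rel = {(R, Q). ring R \<and> ring Q \<and> R \<simeq> Q}"

end

theory Submission
  imports Defs "HOL-Algebra.Weak_Morphisms"
begin

text \<open>
  The idea is that an irredundant cover by \<open>n\<close> subrings has an intersection of index at most
  \<open>n!\<close>, and that a subring of finite index in a unital ring contains a two-sided ideal of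
  bounded index (a quantitative form of Lewin's theorem). Covers of \<open>R / I\<close> correspond to
  covers of \<open>R\<close> by subrings containing \<open>I\<close>, so \<open>\<sigma>(T) = n\<close> is already witnessed by a
  finite quotient of bounded order, and a ring in \<open>S(n)\<close> is itself of bounded order. For the
  characteristic, if \<open>N R = 0\<close> then each proper subring \<open>M\<close> may be enlarged to a proper subring
  \<open>M + p R\<close> for some prime \<open>p\<close> dividing \<open>N\<close>, and by the Chinese remainder theorem the
  enlarged subrings belonging to a single \<open>p\<close> already cover \<open>R\<close>; minimality then forces
  \<open>p R = 0\<close>.
\<close>

section \<open>Subgroups of bounded index\<close>

text \<open>When \<open>H\<close> and \<open>K\<close> are additive subgroups, this bounds the index
  of \<open>H \<inter> K\<close> in \<open>K\<close>. Coset representatives may lie outside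
  \<open>K\<close>, so no quotient group has to be formed.\<close>

definition bounded_index :: "('a, 'b) ring_scheme \<Rightarrow> 'a set \<Rightarrow> 'a set \<Rightarrow> nat \<Rightarrow> bool" where
  "bounded_index R K H m \<longleftrightarrow>
     (\<exists>A \<subseteq> carrier R. finite A \<and> card A \<le> m \<and> (\<forall>x\<in>K. \<exists>a\<in>A. x \<ominus>\<^bsub>R\<^esub> a \<in> H))"

text \<open>One representative is chosen in each fibre of \<open>f\<close>, and any two points of a
  fibre differ by an element of \<open>H\<close>.\<close>

lemma bounded_indexI_fun:
  assumes "K \<subseteq> carrier R" and fB: "f ` K \<subseteq> B" and B: "finite B" "card B \<le> m"
    and eq: "\<And>x y. x \<in> K \<Longrightarrow> y \<in> K \<Longrightarrow> f x = f y \<Longrightarrow> x \<ominus>\<^bsub>R\<^esub> y \<in> H"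
  shows "bounded_index R K H m"
proof -
  define A where "A = inv_into K f ` f ` K"
  have fin: "finite (f ` K)" using fB B(1) by (rule finite_subset)
  have "A \<subseteq> carrier R" unfolding A_def using assms(1) inv_into_into[of _ f K] by fast
  moreover have "card A \<le> m"
    unfolding A_def using card_image_le[OF fin] card_mono[OF B(1) fB] B(2) order_trans by meson
  moreover have "\<forall>x\<in>K. \<exists>a\<in>A. x \<ominus>\<^bsub>R\<^esub> a \<in> H"
  proof
    fix x assume x: "x \<in> K"
    then have "x \<ominus>\<^bsub>R\<^esub> inv_into K f (f x) \<in> H"
      by (intro eq inv_into_into) (auto simp: f_inv_into_f)
    with x show "\<exists>a\<in>A. x \<ominus>\<^bsub>R\<^esub> a \<in> H" unfolding A_def by blast
  qed
  ultimately show ?thesis unfolding bounded_index_def using fin A_def by blast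
qed

text \<open>The bound arises in two stages: \<open>k = m ^ Suc m\<close> for passing from a subring
  to a right ideal inside it, then \<open>k ^ k\<close> for passing from that right ideal to a
  two-sided ideal.\<close>

definition ideal_index_bound :: "nat \<Rightarrow> nat" where
  "ideal_index_bound m = (m ^ Suc m) ^ (m ^ Suc m)"

context ring
begin

lemma diff_mem:
  assumes "additive_subgroup H R" "x \<in> H" "y \<in> H"
  shows "x \<ominus> y \<in> H"
  using assms additive_subgroup.a_closed additive_subgroup.a_inv_closed
  by (metis a_minus_def)

lemma additive_subgroupI':
  assumes "H \<subseteq> carrier R" "\<zero> \<in> H" "\<And>x y. x \<in> H \<Longrightarrow> y \<in> H \<Longrightarrow> x \<ominus> y \<in> H"
  shows "additive_subgroup H R"
proof (rule additive_subgroupI, rule add.subgroupI)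
  have inv: "\<ominus> x \<in> H" if "x \<in> H" for x
    using assms(1) assms(3)[OF assms(2) that] that by (auto simp: a_minus_def)
  then show "\<And>a. a \<in> H \<Longrightarrow> \<ominus> a \<in> H" .
  show "a \<oplus> b \<in> H" if "a \<in> H" "b \<in> H" for a b
    using assms(3)[OF that(1) inv[OF that(2)]] assms(1) that by (auto simp: a_minus_def)
qed (use assms in auto)

lemma idealI':
  assumes "I \<subseteq> carrier R" "\<zero> \<in> I" "\<And>x y. x \<in> I \<Longrightarrow> y \<in> I \<Longrightarrow> x \<ominus> y \<in> I"
    and "\<And>a x. a \<in> I \<Longrightarrow> x \<in> carrier R \<Longrightarrow> x \<otimes> a \<in> I"
    and "\<And>a x. a \<in> I \<Longrightarrow> x \<in> carrier R \<Longrightarrow> a \<otimes> x \<in> I"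
  shows "ideal I R"
  using additive_subgroupI'[of I] assms
  by (intro idealI ring_axioms) (auto simp: additive_subgroup_def)

text \<open>This is the converse of \<open>bounded_indexI_fun\<close>: \<open>f\<close> picks a
  representative of the coset of \<open>x\<close>, so a common value puts \<open>x\<close> and
  \<open>y\<close> in the same coset.\<close>

lemma bounded_index_separating:
  assumes "bounded_index R (carrier R) H m" and H: "additive_subgroup H R"
  obtains A f where "A \<subseteq> carrier R" "finite A" "card A \<le> m"
    "\<And>x. x \<in> carrier R \<Longrightarrow> f x \<in> A \<and> x \<ominus> f x \<in> H"
    "\<And>x y. x \<in> carrier R \<Longrightarrow> y \<in> carrier R \<Longrightarrow> f x = f y \<Longrightarrow> x \<ominus> y \<in> H"
proof -
  obtain A where A: "A \<subseteq> carrier R" "finite A" "card A \<le> m"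
      "\<forall>x\<in>carrier R. \<exists>a\<in>A. x \<ominus> a \<in> H"
    using assms(1) unfolding bounded_index_def by blast
  then obtain f where f: "\<And>x. x \<in> carrier R \<Longrightarrow> f x \<in> A \<and> x \<ominus> f x \<in> H" by metis
  have "x \<ominus> y \<in> H" if "x \<in> carrier R" "y \<in> carrier R" "f x = f y" for x y
  proof -
    have c: "f x \<in> carrier R" using f that A(1) by auto
    have "(x \<ominus> f x) \<ominus> (y \<ominus> f y) \<in> H" by (rule diff_mem[OF H]) (use f that(1,2) in auto)
    moreover have "(x \<ominus> f x) \<ominus> (y \<ominus> f y) = x \<ominus> y"
      using that(1,2) c unfolding that(3)[symmetric] by algebra
    ultimately show ?thesis by simp
  qed
  with A f show ?thesis using that by blast
qed

text \<open>If \<open>g\<close> avoids the members of \<open>\<T>\<close>, then \<open>g + \<Inter>\<T>\<close> is covered by the members of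
  \<open>\<C> - \<T>\<close>, so \<open>\<Inter>\<T>\<close> is a union of cosets of the \<open>H \<inter> \<Inter>\<T>\<close> with \<open>H \<in> \<C> - \<T>\<close>.\<close>

lemma irredundant_Inter_bounded_index:
  assumes C: "finite C" "\<forall>H\<in>C. additive_subgroup H R" "\<Union>C = carrier R"
    and irr: "\<forall>D. D \<subset> C \<longrightarrow> \<Union>D \<noteq> carrier R" and "T \<subseteq> C"
  shows "bounded_index R (carrier R \<inter> \<Inter>T) (carrier R \<inter> \<Inter>C) (fact (card (C - T)))"
  using \<open>T \<subseteq> C\<close>
proof (induction "card (C - T)" arbitrary: T)
  case 0
  then have "T = C" using C(1) by auto
  moreover have "x \<ominus> \<zero> = x" if "x \<in> carrier R" for x using that by algebra
  ultimately show ?case unfolding bounded_index_def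
    by (intro exI[of _ "{\<zero>}"]) auto
next
  case (Suc k)
  have "T \<subset> C" using Suc by auto
  then have "\<Union>T \<subset> carrier R" using irr C(3) by blast
  then obtain g where g: "g \<in> carrier R" "g \<notin> \<Union>T" by blast
  have "\<exists>A. A \<subseteq> carrier R \<and> finite A \<and> card A \<le> fact k \<and>
      (\<forall>x\<in>carrier R \<inter> \<Inter>(insert H T). \<exists>a\<in>A. x \<ominus> a \<in> carrier R \<inter> \<Inter>C)" if H: "H \<in> C - T" for H
  proof -
    have "C - insert H T = (C - T) - {H}" by auto
    then have k: "k = card (C - insert H T)"
      using Suc(2) card_Diff_singleton[OF H] by (metis diff_Suc_1)
    have "bounded_index R (carrier R \<inter> \<Inter>(insert H T)) (carrier R \<inter> \<Inter>C) (fact k)"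
      using Suc(1)[OF k] k H Suc.prems by (metis DiffD1 insert_subset)
    then show ?thesis unfolding bounded_index_def .
  qed
  then obtain A where A: "\<And>H. H \<in> C - T \<Longrightarrow> A H \<subseteq> carrier R \<and> finite (A H) \<and> card (A H) \<le> fact k \<and>
      (\<forall>x\<in>carrier R \<inter> \<Inter>(insert H T). \<exists>a\<in>A H. x \<ominus> a \<in> carrier R \<inter> \<Inter>C)" by metis
  define P where "P H x \<longleftrightarrow> x \<in> carrier R \<inter> \<Inter>T \<and> g \<oplus> x \<in> H" for H x
  \<comment> \<open>When some \<open>x\<close> in the intersection of \<open>T\<close> has
    \<open>g \<oplus> x \<in> H\<close>, \<open>s H\<close> is one such \<open>x\<close>. The
    default \<zero> merely keeps \<open>s H\<close> in the carrier when there is none.\<close>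
  define s where "s H = (if Ex (P H) then Eps (P H) else \<zero>)" for H
  have s: "P H (s H)" if "P H x" for H x
    unfolding s_def using that by (auto intro: someI)
  have s_carrier: "s H \<in> carrier R" for H
  proof (cases "Ex (P H)")
    case True
    then show ?thesis using s[of H] by (auto simp: P_def)
  next
    case False
    then have "s H = \<zero>" unfolding s_def by (rule if_not_P)
    then show ?thesis by simp
  qed
  \<comment> \<open>Subtracting \<open>s H\<close> moves \<open>x\<close> into the intersection over
    \<open>insert H T\<close>, where the induction hypothesis supplies the representatives
    \<open>A H\<close>; shifting them back by \<open>s H\<close> serves \<open>x\<close>.\<close>
  define B where "B = (\<Union>H\<in>C - T. (\<lambda>a. s H \<oplus> a) ` A H)"
  have fin: "finite B" unfolding B_def using A C(1) by auto
  have "card B \<le> (\<Sum>H\<in>C - T. card ((\<lambda>a. s H \<oplus> a) ` A H))"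
    unfolding B_def using C(1) by (intro card_UN_le) auto
  also have "\<dots> \<le> (\<Sum>H\<in>C - T. fact k)"
  proof (rule sum_mono)
    fix H assume "H \<in> C - T"
    then have "finite (A H)" "card (A H) \<le> fact k" using A by auto
    then show "card ((\<lambda>a. s H \<oplus> a) ` A H) \<le> fact k" using card_image_le order_trans by blast
  qed
  \<comment> \<open>There are \<open>Suc k\<close> summands, each equal to
    \<open>fact k\<close>.\<close>
  also have "\<dots> = fact (card (C - T))" using Suc(2)[symmetric] by simp
  finally have card: "card B \<le> fact (card (C - T))" .
  have "\<exists>b\<in>B. x \<ominus> b \<in> carrier R \<inter> \<Inter>C" if x: "x \<in> carrier R" "x \<in> \<Inter>T" for x
  proof -
    have "g \<oplus> x \<notin> H" if H: "H \<in> T" for H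
    proof
      assume "g \<oplus> x \<in> H"
      moreover have "additive_subgroup H R" using H Suc.prems C(2) by auto
      ultimately have "(g \<oplus> x) \<ominus> x \<in> H" using diff_mem x H by auto
      moreover have "(g \<oplus> x) \<ominus> x = g" using g x by algebra
      ultimately show False using g H by auto
    qed
    moreover have "g \<oplus> x \<in> \<Union>C" using g x C(3) by auto
    ultimately obtain H where H: "H \<in> C - T" "g \<oplus> x \<in> H" by auto
    then have "P H x" using x by (auto simp: P_def)
    then have PH: "P H (s H)" by (rule s)
    have "x \<ominus> s H \<in> H'" if "H' \<in> T" for H'
      using that x PH Suc.prems C(2) diff_mem[of H' x "s H"] by (auto simp: P_def)
    moreover have "(g \<oplus> x) \<ominus> (g \<oplus> s H) \<in> H"
      using H PH C(2) diff_mem[of H] by (auto simp: P_def)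
    moreover have "(g \<oplus> x) \<ominus> (g \<oplus> s H) = x \<ominus> s H" using g x s_carrier[of H] by algebra
    ultimately have "x \<ominus> s H \<in> carrier R \<inter> \<Inter>(insert H T)" using x s_carrier by auto
    then obtain a where a: "a \<in> A H" "(x \<ominus> s H) \<ominus> a \<in> carrier R \<inter> \<Inter>C"
      using A[OF H(1)] by blast
    moreover have "a \<in> carrier R" using a A[OF H(1)] by auto
    then have "(x \<ominus> s H) \<ominus> a = x \<ominus> (s H \<oplus> a)" using x s_carrier[of H] by algebra
    ultimately show ?thesis using H(1) unfolding B_def by auto
  qed
  moreover have "B \<subseteq> carrier R"
  proof
    fix b assume "b \<in> B"
    then obtain H a where "H \<in> C - T" "a \<in> A H" "b = s H \<oplus> a" unfolding B_def by blast
    moreover from this have "a \<in> carrier R" using A by blast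
    ultimately show "b \<in> carrier R" using s_carrier by simp
  qed
  ultimately show ?case
    unfolding bounded_index_def using fin card by (intro exI[of _ B]) blast
qed

section \<open>Two-sided ideals inside a subring of bounded index\<close>

text \<open>The set is the largest right ideal contained in \<open>H\<close>. The class of
  \<open>h\<close> is determined modulo it by the classes modulo \<open>H\<close> of
  \<open>h\<close> and of its products with the representatives in \<open>A\<close>, which leaves at
  most \<open>m * m ^ m\<close> possibilities.\<close>

lemma bounded_index_right_multiplier:
  assumes H: "subrng H R" and "bounded_index R (carrier R) H m"
  shows "bounded_index R (carrier R) {h \<in> carrier R. \<forall>y\<in>carrier R. h \<otimes> y \<in> H} (m ^ Suc m)"
proof -
  have Ha: "additive_subgroup H R" using H by (simp add: subrng_def)
  then interpret H: additive_subgroup H R .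
  obtain A f where A: "A \<subseteq> carrier R" "finite A" "card A \<le> m"
    and f: "\<And>x. x \<in> carrier R \<Longrightarrow> f x \<in> A \<and> x \<ominus> f x \<in> H"
    and sep: "\<And>x y. x \<in> carrier R \<Longrightarrow> y \<in> carrier R \<Longrightarrow> f x = f y \<Longrightarrow> x \<ominus> y \<in> H"
    using bounded_index_separating[OF assms(2) Ha] by blast
  define F where "F h = (f h, restrict (\<lambda>a. f (h \<otimes> a)) A)" for h
  have "m > 0" using A f[OF zero_closed] card_gt_0_iff by (metis empty_iff gr0I le_zero_eq)
  show ?thesis
  proof (rule bounded_indexI_fun)
    show "F ` carrier R \<subseteq> A \<times> (A \<rightarrow>\<^sub>E A)" using f A unfolding F_def by auto
    have "card (A \<times> (A \<rightarrow>\<^sub>E A)) = card A ^ Suc (card A)"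
      using A by (simp add: card_cartesian_product card_funcsetE)
    also have "\<dots> \<le> m ^ Suc (card A)" using A(3) by (rule power_mono) simp
    also have "\<dots> \<le> m ^ Suc m" using A(3) \<open>m > 0\<close> by (intro power_increasing) auto
    finally show "card (A \<times> (A \<rightarrow>\<^sub>E A)) \<le> m ^ Suc m" .
    fix u v assume uv: "u \<in> carrier R" "v \<in> carrier R" "F u = F v"
    then have uvH: "u \<ominus> v \<in> H" using sep by (auto simp: F_def)
    have "(u \<ominus> v) \<otimes> y \<in> H" if y: "y \<in> carrier R" for y
    proof -
      have fy: "f y \<in> A" "f y \<in> carrier R" "y \<ominus> f y \<in> H" using f y A by auto
      have "snd (F u) (f y) = snd (F v) (f y)" using uv(3) by simp
      then have "f (u \<otimes> f y) = f (v \<otimes> f y)" using fy by (simp add: F_def)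
      then have "u \<otimes> f y \<ominus> v \<otimes> f y \<in> H" using sep uv fy by auto
      moreover have "(u \<ominus> v) \<otimes> (y \<ominus> f y) \<in> H" using H uvH fy by (auto simp: subrng_def)
      \<comment> \<open>Split \<open>y\<close> into its representative \<open>f y\<close> and a
        remainder in \<open>H\<close>. The first summand is controlled by the recorded products, the
        second is a product of two elements of \<open>H\<close>; this is why \<open>F\<close> also
        records \<open>f h\<close>.\<close>
      moreover have "(u \<ominus> v) \<otimes> y = (u \<otimes> f y \<ominus> v \<otimes> f y) \<oplus> (u \<ominus> v) \<otimes> (y \<ominus> f y)"
        using uv fy y by algebra
      ultimately show ?thesis by auto
    qed
    then show "u \<ominus> v \<in> {h \<in> carrier R. \<forall>y\<in>carrier R. h \<otimes> y \<in> H}" using uv by auto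
  qed (use A in \<open>auto intro: finite_PiE\<close>)
qed

text \<open>Repeat the multiplier construction on the left, starting from the right ideal
  \<open>K\<close> of the previous lemma. The result \<open>J\<close> absorbs on the left by its
  definition, and on the right because \<open>K\<close> does.\<close>

lemma ideal_in_subrng_bounded_index:
  assumes H: "subrng H R" and bd: "bounded_index R (carrier R) H m"
  obtains J where "ideal J R" "J \<subseteq> H" "bounded_index R (carrier R) J (ideal_index_bound m)"
proof -
  define K where "K = {h \<in> carrier R. \<forall>y\<in>carrier R. h \<otimes> y \<in> H}"
  define J where "J = {r \<in> carrier R. \<forall>x\<in>carrier R. x \<otimes> r \<in> K}"
  define k where "k = m ^ Suc m"
  have Ha: "additive_subgroup H R" using H by (simp add: subrng_def)
  then interpret H: additive_subgroup H R .
  have K_diff: "u \<ominus> v \<in> K" if "u \<in> K" "v \<in> K" for u v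
  proof -
    have "(u \<ominus> v) \<otimes> y = u \<otimes> y \<ominus> v \<otimes> y" if "y \<in> carrier R" for y
      using that \<open>u \<in> K\<close> \<open>v \<in> K\<close> unfolding K_def by (simp add: a_minus_def l_distr l_minus)
    then show ?thesis using that diff_mem[OF Ha] unfolding K_def by auto
  qed
  have K_zero: "\<zero> \<in> K" unfolding K_def by auto
  have K_right: "u \<otimes> x \<in> K" if "u \<in> K" "x \<in> carrier R" for u x
    using that unfolding K_def by (auto simp: m_assoc)
  have K_carrier: "K \<subseteq> carrier R" by (auto simp: K_def)
  have Ka: "additive_subgroup K R" by (rule additive_subgroupI'[OF K_carrier K_zero K_diff])
  then interpret K: additive_subgroup K R .
  have J: "ideal J R"
  proof (rule idealI')
    show "u \<ominus> v \<in> J" if "u \<in> J" "v \<in> J" for u v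
    proof -
      have "x \<otimes> (u \<ominus> v) = x \<otimes> u \<ominus> x \<otimes> v" if "x \<in> carrier R" for x
        using that \<open>u \<in> J\<close> \<open>v \<in> J\<close> unfolding J_def by (simp add: a_minus_def r_distr r_minus)
      then show ?thesis using that K_diff unfolding J_def by auto
    qed
    fix a x assume a: "a \<in> J" and x: "x \<in> carrier R"
    have "y \<otimes> (x \<otimes> a) \<in> K" if "y \<in> carrier R" for y
      using that a x m_assoc[of y x a, symmetric] unfolding J_def by auto
    then show "x \<otimes> a \<in> J" using a x unfolding J_def by auto
    have "y \<otimes> (a \<otimes> x) \<in> K" if "y \<in> carrier R" for y
      using that a x K_right m_assoc[of y a x, symmetric] unfolding J_def by auto
    then show "a \<otimes> x \<in> J" using a x unfolding J_def by auto
  qed (auto simp: J_def K_zero)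
  \<comment> \<open>The identity of the ring, used as a multiplier, gives both this inclusion and
    the next one.\<close>
  have "J \<subseteq> K" unfolding J_def by (metis (no_types, lifting) l_one mem_Collect_eq one_closed subsetI)
  moreover have "K \<subseteq> H" unfolding K_def by (metis (no_types, lifting) r_one mem_Collect_eq one_closed subsetI)
  ultimately have "J \<subseteq> H" by blast
  have "bounded_index R (carrier R) K k"
    using bounded_index_right_multiplier[OF H bd] unfolding K_def k_def .
  then obtain A f where A: "A \<subseteq> carrier R" "finite A" "card A \<le> k"
    and f: "\<And>x. x \<in> carrier R \<Longrightarrow> f x \<in> A \<and> x \<ominus> f x \<in> K"
    and sep: "\<And>x y. x \<in> carrier R \<Longrightarrow> y \<in> carrier R \<Longrightarrow> f x = f y \<Longrightarrow> x \<ominus> y \<in> K"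
    using bounded_index_separating[OF _ Ka] by blast
  \<comment> \<open>The class of \<open>r\<close> itself need not be recorded: the remainder term
    \<open>(x \<ominus> f x) \<otimes> (u \<ominus> v)\<close> lies in \<open>K\<close> because
    \<open>K\<close> is a right ideal. Hence the exponent is \<open>k\<close> rather than
    \<open>Suc k\<close>.\<close>
  define F where "F r = restrict (\<lambda>a. f (a \<otimes> r)) A" for r
  have "k > 0" using A f[OF zero_closed] card_gt_0_iff by (metis empty_iff gr0I le_zero_eq)
  have "bounded_index R (carrier R) J (k ^ k)"
  proof (rule bounded_indexI_fun)
    show "F ` carrier R \<subseteq> (A \<rightarrow>\<^sub>E A)" using f A unfolding F_def by auto
    have "card (A \<rightarrow>\<^sub>E A) = card A ^ card A" using A by (simp add: card_funcsetE)
    also have "\<dots> \<le> k ^ card A" using A(3) by (rule power_mono) simp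
    also have "\<dots> \<le> k ^ k" using A(3) \<open>k > 0\<close> by (intro power_increasing) auto
    finally show "card (A \<rightarrow>\<^sub>E A) \<le> k ^ k" .
    fix u v assume uv: "u \<in> carrier R" "v \<in> carrier R" "F u = F v"
    have "x \<otimes> (u \<ominus> v) \<in> K" if x: "x \<in> carrier R" for x
    proof -
      have fx: "f x \<in> A" "f x \<in> carrier R" "x \<ominus> f x \<in> K" using f x A by auto
      have "F u (f x) = F v (f x)" using uv(3) by simp
      then have "f (f x \<otimes> u) = f (f x \<otimes> v)" using fx by (simp add: F_def)
      then have "f x \<otimes> u \<ominus> f x \<otimes> v \<in> K" using sep uv fx by auto
      moreover have "(x \<ominus> f x) \<otimes> (u \<ominus> v) \<in> K" using K_right fx uv by auto
      moreover have "x \<otimes> (u \<ominus> v) = (f x \<otimes> u \<ominus> f x \<otimes> v) \<oplus> (x \<ominus> f x) \<otimes> (u \<ominus> v)"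
        using uv fx x by algebra
      ultimately show ?thesis by auto
    qed
    then show "u \<ominus> v \<in> J" using uv unfolding J_def by auto
  qed (use A in \<open>auto intro: finite_PiE\<close>)
  then have "bounded_index R (carrier R) J (ideal_index_bound m)"
    by (simp add: k_def ideal_index_bound_def)
  with J \<open>J \<subseteq> H\<close> show ?thesis using that by blast
qed

text \<open>An ideal above \<open>J\<close> is a union of cosets of \<open>J\<close>, hence
  determined by which of the finitely many representatives it contains.\<close>

lemma finite_ideals_above_bounded_index:
  assumes "bounded_index R (carrier R) J m" "ideal J R"
  shows "finite {I. ideal I R \<and> J \<subseteq> I}"
proof -
  interpret J: ideal J R by fact
  obtain A f where A: "A \<subseteq> carrier R" "finite A"
    and f: "\<And>x. x \<in> carrier R \<Longrightarrow> f x \<in> A \<and> x \<ominus> f x \<in> J"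
    using bounded_index_separating[OF assms(1) J.is_additive_subgroup] by metis
  define G where "G B = {x \<in> carrier R. f x \<in> B}" for B
  have "I = G (A \<inter> I)" if I: "ideal I R" "J \<subseteq> I" for I
  proof -
    interpret I: ideal I R by fact
    have "x \<in> I \<longleftrightarrow> f x \<in> I" if x: "x \<in> carrier R" for x
    proof -
      have fx: "f x \<in> carrier R" "x \<ominus> f x \<in> I" using f[OF x] A I by auto
      have "x = (x \<ominus> f x) \<oplus> f x" "f x = x \<ominus> (x \<ominus> f x)" using x fx by algebra+
      then show ?thesis using fx diff_mem[OF I.is_additive_subgroup] I.a_closed by metis
    qed
    then show ?thesis unfolding G_def using f I.a_subset by blast
  qed
  then have "{I. ideal I R \<and> J \<subseteq> I} \<subseteq> (\<lambda>I. G (A \<inter> I)) ` UNIV" by blast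
  also have "\<dots> \<subseteq> G ` Pow A" by blast
  finally have "{I. ideal I R \<and> J \<subseteq> I} \<subseteq> G ` Pow A" .
  then show ?thesis by (rule finite_subset) (simp add: A)
qed

end

section \<open>Covers containing a given ideal\<close>

text \<open>For an ideal \<open>I\<close> this expresses inside \<open>R\<close> that the covering
  number of the quotient by \<open>I\<close> is at most \<open>n\<close>; see
  \<open>covering_number_Quot_le_iff\<close>. The inequality on \<open>card C\<close> avoids having
  to show that images or preimages of distinct members stay distinct.\<close>

definition covered_above :: "('a, 'b) ring_scheme \<Rightarrow> 'a set \<Rightarrow> nat \<Rightarrow> bool" where
  "covered_above R I n \<longleftrightarrow> (\<exists>C. finite C \<and> card C \<le> n \<and> ring_cover C R \<and> (\<forall>H\<in>C. I \<subseteq> H))"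

lemma subrng_zero_closed: "subrng H R \<Longrightarrow> \<zero>\<^bsub>R\<^esub> \<in> H"
  unfolding subrng_def by (simp add: additive_subgroup.zero_closed)

text \<open>A finite bound excludes an empty set of cover sizes, whose infimum is \<infinity>, and
  the infimum of a nonempty set in \<open>enat\<close> is its least element.\<close>

lemma covering_number_attained:
  assumes "covering_number R \<le> enat n"
  obtains C where "finite C" "ring_cover C R" "covering_number R = enat (card C)" "card C \<le> n"
proof -
  let ?A = "{enat (card C) |C. finite C \<and> ring_cover C R}"
  have "?A \<noteq> {}"
  proof
    assume "?A = {}"
    then have "covering_number R = Inf {}" unfolding covering_number_def by (rule arg_cong)
    then show False using assms by (simp add: Inf_enat_def)
  qed
  then have ex: "\<exists>x. x \<in> ?A" by (rule ex_in_conv[THEN iffD2])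
  have "Inf ?A = (LEAST x. x \<in> ?A)" unfolding Inf_enat_def by (rule if_not_P) fact
  then have "Inf ?A \<in> ?A" using LeastI_ex[OF ex] by (rule ssubst)
  then obtain C where "finite C" "ring_cover C R" "covering_number R = enat (card C)"
    unfolding covering_number_def by blast
  with assms show ?thesis using that by auto
qed

lemma covering_number_le:
  assumes "finite C" "ring_cover C R"
  shows "covering_number R \<le> enat (card C)"
  unfolding covering_number_def using assms by (intro Inf_lower) blast

text \<open>Every subring contains zero, so the containment condition is automatic here.\<close>

lemma covering_number_le_iff: "covering_number R \<le> enat n \<longleftrightarrow> covered_above R {\<zero>\<^bsub>R\<^esub>} n"
proof
  assume "covering_number R \<le> enat n"
  then show "covered_above R {\<zero>\<^bsub>R\<^esub>} n"
    by (elim covering_number_attained)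
      (auto simp: covered_above_def ring_cover_def intro!: subrng_zero_closed)
next
  assume "covered_above R {\<zero>\<^bsub>R\<^esub>} n"
  then obtain C where "finite C" "card C \<le> n" "ring_cover C R" unfolding covered_above_def by blast
  then show "covering_number R \<le> enat n" using covering_number_le order_trans enat_ord_simps(1) by metis
qed

lemma minimal_cover:
  assumes "covering_number R = enat n"
  obtains C where "finite C" "card C = n" "ring_cover C R" "\<And>D. D \<subset> C \<Longrightarrow> \<Union>D \<noteq> carrier R"
proof -
  obtain C where C: "finite C" "ring_cover C R" "card C = n"
    using covering_number_attained[of R n] assms by auto
  have "\<Union>D \<noteq> carrier R" if D: "D \<subset> C" for D
  proof
    assume "\<Union>D = carrier R"
    then have "ring_cover D R" using C(2) D unfolding ring_cover_def by blast
    then have "enat n \<le> enat (card D)"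
      using covering_number_le[of D R] assms D C(1) finite_subset by auto
    then show False using psubset_card_mono[OF C(1) D] C(3) by simp
  qed
  with C show ?thesis using that by blast
qed

lemma covered_above_mono: "covered_above R J n \<Longrightarrow> I \<subseteq> J \<Longrightarrow> covered_above R I n"
  unfolding covered_above_def by blast

lemma ring_hom_ring_diff:
  assumes "ring_hom_ring R Q h" "x \<in> carrier R" "y \<in> carrier R"
  shows "h (x \<ominus>\<^bsub>R\<^esub> y) = h x \<ominus>\<^bsub>Q\<^esub> h y"
proof -
  interpret ring_hom_ring R Q h by fact
  show ?thesis using assms(2,3) by (simp add: a_minus_def)
qed

text \<open>Covers are transported by preimages and by images. Preimages of proper subrings are
  proper because \<open>h\<close> is surjective; images are proper because the members contain the
  kernel. The lemma serves projections to quotients as well as isomorphisms.\<close>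

lemma covered_above_vimage_iff:
  assumes hom: "ring_hom_ring R Q h" and surj: "h ` carrier R = carrier Q" and J: "\<zero>\<^bsub>Q\<^esub> \<in> J"
    "J \<subseteq> carrier Q"
  shows "covered_above Q J n \<longleftrightarrow> covered_above R {x \<in> carrier R. h x \<in> J} n"
proof -
  interpret ring_hom_ring R Q h by fact
  note diff = ring_hom_ring_diff[OF hom]
  show ?thesis
  proof
    assume "covered_above Q J n"
    then obtain C where C: "finite C" "card C \<le> n" "ring_cover C Q" "\<forall>H\<in>C. J \<subseteq> H"
      unfolding covered_above_def by blast
    define V where "V H = {x \<in> carrier R. h x \<in> H}" for H
    have "subrng (V H) R" if "subrng H Q" for H
    proof -
      have H: "additive_subgroup H Q" "\<forall>x\<in>H. \<forall>y\<in>H. x \<otimes>\<^bsub>Q\<^esub> y \<in> H" using that by (auto simp: subrng_def)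
      have "additive_subgroup (V H) R"
      proof (rule R.additive_subgroupI')
        show "\<zero>\<^bsub>R\<^esub> \<in> V H" using additive_subgroup.zero_closed[OF H(1)] by (simp add: V_def)
        show "x \<ominus>\<^bsub>R\<^esub> y \<in> V H" if "x \<in> V H" "y \<in> V H" for x y
        proof -
          have xy: "x \<in> carrier R" "y \<in> carrier R" "h x \<in> H" "h y \<in> H" using that by (auto simp: V_def)
          have "h (x \<ominus>\<^bsub>R\<^esub> y) \<in> H" unfolding diff[OF xy(1,2)] by (rule S.diff_mem[OF H(1) xy(3,4)])
          then show ?thesis using xy(1,2) by (simp add: V_def)
        qed
      qed (auto simp: V_def)
      then show ?thesis using H(2) by (auto simp: subrng_def V_def)
    qed
    moreover have "V H \<noteq> carrier R" if "subrng H Q" "H \<noteq> carrier Q" for H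
    proof
      assume "V H = carrier R"
      then have "h ` carrier R \<subseteq> H" unfolding V_def by blast
      then have "carrier Q \<subseteq> H" using surj by simp
      then show False using that additive_subgroup.a_subset[of H Q] unfolding subrng_def by blast
    qed
    moreover have "\<Union>(V ` C) = carrier R" using C(3) unfolding ring_cover_def V_def by auto
    ultimately have "ring_cover (V ` C) R" using C(3) unfolding ring_cover_def by auto
    moreover have "card (V ` C) \<le> n" using card_image_le[OF C(1)] C(2) order_trans by blast
    ultimately show "covered_above R {x \<in> carrier R. h x \<in> J} n"
      unfolding covered_above_def using C(1,4) by (intro exI[of _ "V ` C"]) (auto simp: V_def)
  next
    assume "covered_above R {x \<in> carrier R. h x \<in> J} n"
    then obtain C where C: "finite C" "card C \<le> n" "ring_cover C R"
      "\<forall>H\<in>C. {x \<in> carrier R. h x \<in> J} \<subseteq> H"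
      unfolding covered_above_def by blast
    have "subrng (h ` H) Q" if "subrng H R" for H
    proof -
      have H: "additive_subgroup H R" "\<forall>x\<in>H. \<forall>y\<in>H. x \<otimes>\<^bsub>R\<^esub> y \<in> H" "H \<subseteq> carrier R"
        using that additive_subgroup.a_subset[of H R] by (auto simp: subrng_def)
      have "additive_subgroup (h ` H) Q"
      proof (rule S.additive_subgroupI')
        show "\<zero>\<^bsub>Q\<^esub> \<in> h ` H" using additive_subgroup.zero_closed[OF H(1)] hom_zero by (metis imageI)
        show "u \<ominus>\<^bsub>Q\<^esub> v \<in> h ` H" if uv: "u \<in> h ` H" "v \<in> h ` H" for u v
        proof -
          obtain x y where xy: "x \<in> H" "y \<in> H" "u = h x" "v = h y" using uv by blast
          from xy(1,2) have "u \<ominus>\<^bsub>Q\<^esub> v = h (x \<ominus>\<^bsub>R\<^esub> y)"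
            unfolding xy(3,4) using H(3) by (intro diff[symmetric]) blast+
          then show ?thesis using R.diff_mem[OF H(1) xy(1,2)] by simp
        qed
      qed (use H(3) in auto)
      moreover have "u \<otimes>\<^bsub>Q\<^esub> v \<in> h ` H" if uv: "u \<in> h ` H" "v \<in> h ` H" for u v
      proof -
        obtain x y where "x \<in> H" "y \<in> H" "u = h x" "v = h y" using uv by auto
        then show ?thesis using H hom_mult[of x y] by (metis imageI subsetD)
      qed
      ultimately show ?thesis by (auto simp: subrng_def)
    qed
    moreover have "h ` H \<noteq> carrier Q" if H: "H \<in> C" for H
    proof
      assume eq: "h ` H = carrier Q"
      have HR: "additive_subgroup H R" "H \<subset> carrier R"
        using C(3) H additive_subgroup.a_subset[of H R] unfolding ring_cover_def subrng_def by auto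
      \<comment> \<open>An element with the same image as some \<open>y \<in> H\<close> differs from
        \<open>y\<close> by a kernel element, and the kernel lies in the preimage of
        \<open>J\<close>, hence in \<open>H\<close>.\<close>
      have "x \<in> H" if x: "x \<in> carrier R" for x
      proof -
        have "h x \<in> h ` H" using eq x by simp
        then obtain y where y: "y \<in> H" "h x = h y" by auto
        have yR: "y \<in> carrier R" using y HR by auto
        have "h (x \<ominus>\<^bsub>R\<^esub> y) = \<zero>\<^bsub>Q\<^esub>" using diff[OF x yR] y(2) yR by (simp add: a_minus_def S.r_neg)
        then have "x \<ominus>\<^bsub>R\<^esub> y \<in> {x \<in> carrier R. h x \<in> J}" using J(1) x yR by simp
        then have "x \<ominus>\<^bsub>R\<^esub> y \<in> H" using C(4) H by blast
        moreover have "x = (x \<ominus>\<^bsub>R\<^esub> y) \<oplus>\<^bsub>R\<^esub> y" using x yR by algebra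
        ultimately show ?thesis using y(1) additive_subgroup.a_closed[OF HR(1)] by metis
      qed
      then show False using HR by auto
    qed
    moreover have "\<Union>((`) h ` C) = h ` \<Union>C" by blast
    then have "\<Union>((`) h ` C) = carrier Q" using C(3) surj by (simp add: ring_cover_def)
    ultimately have "ring_cover ((`) h ` C) Q" using C(3) unfolding ring_cover_def by auto
    moreover have "card ((`) h ` C) \<le> n" using card_image_le[OF C(1)] C(2) order_trans by blast
    moreover have "J \<subseteq> h ` H" if "H \<in> C" for H
    proof
      fix j assume "j \<in> J"
      moreover from this obtain x where "x \<in> carrier R" "j = h x" using J(2) surj by auto
      ultimately show "j \<in> h ` H" using C(4) that by auto
    qed
    ultimately show "covered_above Q J n"
      unfolding covered_above_def using C(1) by (intro exI[of _ "(`) h ` C"]) auto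
  qed
qed

lemma FactRing_hom_surj:
  "(+>\<^bsub>R\<^esub>) I ` carrier R = carrier (R Quot I)"
  by (auto simp: FactRing_def A_RCOSETS_def')

text \<open>Transport along the projection, with the zero ideal of the quotient as \<open>J\<close>;
  its preimage is \<open>I\<close>.\<close>

lemma covering_number_Quot_le_iff:
  assumes "ideal I R"
  shows "covering_number (R Quot I) \<le> enat n \<longleftrightarrow> covered_above R I n"
proof -
  interpret ideal I R by fact
  have "{x \<in> carrier R. I +>\<^bsub>R\<^esub> x \<in> {\<zero>\<^bsub>R Quot I\<^esub>}} = I"
  proof -
    have "I +>\<^bsub>R\<^esub> x = I \<longleftrightarrow> x \<in> I" if "x \<in> carrier R" for x
      using that a_rcos_const rcos_const_imp_mem by metis
    moreover have "\<zero>\<^bsub>R Quot I\<^esub> = I" by (simp add: FactRing_def)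
    ultimately show ?thesis using a_subset by blast
  qed
  then show ?thesis
    unfolding covering_number_le_iff
    using covered_above_vimage_iff[OF rcos_ring_hom_ring FactRing_hom_surj, of "{\<zero>\<^bsub>R Quot I\<^esub>}" n]
      ring.ring_simprules(2)[OF quotient_is_ring] by simp
qed

section \<open>Irredundant covers\<close>

context ring
begin

lemma add_pow_mem:
  assumes "additive_subgroup H R" "x \<in> H"
  shows "[(k::nat)] \<cdot> x \<in> H"
proof (induction k)
  case 0
  then show ?case using additive_subgroup.zero_closed[OF assms(1)] by simp
next
  case (Suc k)
  then show ?case using additive_subgroup.a_closed[OF assms(1) Suc assms(2)] by simp
qed

lemma add_pow_diff:
  assumes "x \<in> carrier R" "y \<in> carrier R"
  shows "[(k::nat)] \<cdot> (x \<ominus> y) = [k] \<cdot> x \<ominus> [k] \<cdot> y"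
  using assms by (simp add: a_minus_def add.nat_pow_distrib add.nat_pow_inv)

text \<open>Since \<open>d\<close> is invertible modulo \<open>p\<close>, some multiple of
  \<open>[d] \<cdot> x\<close> equals \<open>x\<close>.\<close>

lemma mem_of_add_pow_mem:
  assumes p: "prime (p::nat)" "[p] \<cdot> x = \<zero>" and d: "0 < d" "d < p"
    and H: "additive_subgroup H R" "[d] \<cdot> x \<in> H" and x: "x \<in> carrier R"
  shows "x \<in> H"
proof -
  have "\<not> p dvd d" using d by (rule nat_dvd_not_less)
  then have "coprime p d" using p(1) by (rule prime_imp_coprime[rotated])
  then have "gcd d p = 1" by (simp add: coprime_iff_gcd_eq_1 gcd.commute)
  then obtain u v where uv: "d * u = p * v + 1" using bezout_nat[of d p] d(1) by auto
  have "[u] \<cdot> ([d] \<cdot> x) = [(d * u)] \<cdot> x" using x by (rule add.nat_pow_pow)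
  also have "\<dots> = [(p * v)] \<cdot> x \<oplus> x" using x by (simp add: uv)
  also have "[(p * v)] \<cdot> x = [v] \<cdot> ([p] \<cdot> x)" using x by (rule add.nat_pow_pow[symmetric])
  also have "\<dots> = \<zero>" by (simp add: p(2))
  finally have "[u] \<cdot> ([d] \<cdot> x) = x" using x by simp
  then show ?thesis using add_pow_mem[OF H, of u] by simp
qed

text \<open>If \<open>x\<close> lies in \<open>M\<close> only and \<open>y \<notin> M\<close>, then no \<open>y + kx\<close> lies in \<open>M\<close>, and each
  other member of the cover contains \<open>y + kx\<close> for at most one \<open>k < p\<close>.\<close>

lemma irredundant_cover_card_gt:
  assumes C: "finite C" "ring_cover C R" and irr: "\<And>D. D \<subset> C \<Longrightarrow> \<Union>D \<noteq> carrier R"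
    and tors: "\<And>H x d. H \<in> C \<Longrightarrow> x \<in> carrier R \<Longrightarrow> 0 < d \<Longrightarrow> d < (p::nat) \<Longrightarrow> [d] \<cdot> x \<in> H \<Longrightarrow> x \<in> H"
  shows "p < card C"
proof (rule ccontr)
  assume "\<not> p < card C"
  have sub: "additive_subgroup H R" "H \<subseteq> carrier R" "H \<noteq> carrier R" if "H \<in> C" for H
    using that C(2) unfolding ring_cover_def subrng_def by auto
  have un: "\<Union>C = carrier R" using C(2) unfolding ring_cover_def by blast
  then obtain M where M: "M \<in> C" using zero_closed by blast
  then have "C - {M} \<subset> C" by blast
  from irr[OF this] obtain x where x: "x \<in> carrier R" "x \<notin> \<Union>(C - {M})" using un by blast
  then have xM: "x \<in> M" using un by blast
  obtain y where y: "y \<in> carrier R" "y \<notin> M" using sub[OF M] by blast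
  have "\<exists>H\<in>C - {M}. y \<oplus> [k] \<cdot> x \<in> H" for k :: nat
  proof -
    have "y \<oplus> [k] \<cdot> x \<notin> M"
    proof
      assume "y \<oplus> [k] \<cdot> x \<in> M"
      then have "(y \<oplus> [k] \<cdot> x) \<ominus> [k] \<cdot> x \<in> M" using diff_mem add_pow_mem sub(1)[OF M] xM by simp
      moreover have "(y \<oplus> z) \<ominus> z = y" if "z \<in> carrier R" for z using y(1) that by algebra
      ultimately show False using y x by simp
    qed
    moreover have "y \<oplus> [k] \<cdot> x \<in> \<Union>C" using un x y by simp
    ultimately show ?thesis by blast
  qed
  then obtain f where f: "\<And>k::nat. f k \<in> C - {M}" "\<And>k::nat. y \<oplus> [k] \<cdot> x \<in> f k" by metis
  \<comment> \<open>The \<open>p\<close> elements \<open>y \<oplus> [k] \<cdot> x\<close> with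
    \<open>k < p\<close> are distributed over \<open>card C - 1 < p\<close> members, so two of them
    share a member. Their difference is a positive multiple of \<open>x\<close> below
    \<open>p\<close>, which \<open>tors\<close> cancels.\<close>
  have "card (f ` {..<p}) \<le> card (C - {M})" using f(1) C(1) by (intro card_mono) auto
  also have "\<dots> < card C" using M C(1) by (intro card_Diff1_less)
  also have "\<dots> \<le> card {..<p}" using \<open>\<not> p < card C\<close> by simp
  finally have "\<not> inj_on f {..<p}" by (rule pigeonhole)
  then obtain i j where ij: "i < j" "j < p" "f i = f j"
    unfolding inj_on_def by (metis lessThan_iff linorder_neqE_nat)
  have fj: "f j \<in> C" using f(1) by blast
  have "[i] \<cdot> x \<oplus> [(j - i)] \<cdot> x = [j] \<cdot> x" using x(1) ij(1) by (simp add: add.nat_pow_mult)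
  moreover have "(y \<oplus> (a \<oplus> b)) \<ominus> (y \<oplus> a) = b" if "a \<in> carrier R" "b \<in> carrier R" for a b
    using y(1) that by algebra
  ultimately have "(y \<oplus> [j] \<cdot> x) \<ominus> (y \<oplus> [i] \<cdot> x) = [(j - i)] \<cdot> x" using x(1) by (metis add.nat_pow_closed)
  moreover have "(y \<oplus> [j] \<cdot> x) \<ominus> (y \<oplus> [i] \<cdot> x) \<in> f j"
    using diff_mem[OF sub(1)[OF fj] f(2)[of j]] f(2)[of i] ij(3) by simp
  ultimately have "x \<in> f j" using tors[OF fj x(1), of "j - i"] ij by simp
  then show False using x(2) f(1) by blast
qed

text \<open>For \<open>p = 2\<close> the cancellation hypothesis of
  \<open>irredundant_cover_card_gt\<close> concerns only \<open>d = 1\<close> and is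
  trivial.\<close>

lemma covering_number_ge_3:
  assumes "covering_number R = enat n"
  shows "3 \<le> n"
proof -
  obtain C where C: "finite C" "card C = n" "ring_cover C R" "\<And>D. D \<subset> C \<Longrightarrow> \<Union>D \<noteq> carrier R"
    using minimal_cover[OF assms] by blast
  have "2 < card C"
  proof (rule irredundant_cover_card_gt[OF C(1,3,4)])
    fix H x and d :: nat assume "x \<in> carrier R" "0 < d" "d < 2" "[d] \<cdot> x \<in> H"
    moreover from this have "d = 1" by simp
    ultimately show "x \<in> H" by simp
  qed
  with C show ?thesis by simp
qed

text \<open>The intersection of a minimal cover has index at most \<open>fact n\<close>, by the case
  \<open>T = {}\<close> of \<open>irredundant_Inter_bounded_index\<close>. An ideal inside it lies
  in every member, so the same cover works above that ideal.\<close>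

lemma cover_le_ideal_bounded_index:
  assumes "covering_number R = enat n"
  obtains J where "ideal J R" "covered_above R J n"
    "bounded_index R (carrier R) J (ideal_index_bound (fact n))"
proof -
  obtain C where C: "finite C" "card C = n" "ring_cover C R" "\<And>D. D \<subset> C \<Longrightarrow> \<Union>D \<noteq> carrier R"
    using minimal_cover[OF assms] by blast
  have sub: "additive_subgroup H R" "\<forall>x\<in>H. \<forall>y\<in>H. x \<otimes> y \<in> H" if "H \<in> C" for H
    using that C(3) unfolding ring_cover_def subrng_def by auto
  define D where "D = carrier R \<inter> \<Inter>C"
  have "additive_subgroup D R"
  proof (rule additive_subgroupI')
    show "\<zero> \<in> D" using sub(1) additive_subgroup.zero_closed unfolding D_def by blast
    show "x \<ominus> y \<in> D" if "x \<in> D" "y \<in> D" for x y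
      using that sub(1) diff_mem unfolding D_def by blast
  qed (simp add: D_def)
  then have "subrng D R" using sub(2) unfolding subrng_def D_def by blast
  moreover have "bounded_index R (carrier R) D (fact n)"
    using irredundant_Inter_bounded_index[OF C(1), of "{}"] sub(1) C unfolding D_def ring_cover_def
    by simp
  ultimately obtain J where J: "ideal J R" "J \<subseteq> D"
    "bounded_index R (carrier R) J (ideal_index_bound (fact n))"
    using ideal_in_subrng_bounded_index by blast
  moreover have "covered_above R J n"
    unfolding covered_above_def using C J(2) unfolding D_def by (intro exI[of _ C]) blast
  ultimately show ?thesis using that by blast
qed

section \<open>Reduction to prime characteristic\<close>

abbreviation mult_ideal :: "nat \<Rightarrow> 'a set" where
  "mult_ideal k \<equiv> (\<lambda>x. [k] \<cdot> x) ` carrier R"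

lemma ideal_mult_ideal: "ideal (mult_ideal k) R"
proof (rule idealI')
  show "\<zero> \<in> mult_ideal k" using add.nat_pow_one[of k] zero_closed by (intro image_eqI[of _ _ \<zero>]) auto
  show "u \<ominus> v \<in> mult_ideal k" if uv: "u \<in> mult_ideal k" "v \<in> mult_ideal k" for u v
  proof -
    obtain x y where "x \<in> carrier R" "u = [k] \<cdot> x" "y \<in> carrier R" "v = [k] \<cdot> y" using uv by blast
    then have "u \<ominus> v = [k] \<cdot> (x \<ominus> y)" "x \<ominus> y \<in> carrier R" by (simp_all add: add_pow_diff)
    then show ?thesis by blast
  qed
  fix a x assume a: "a \<in> mult_ideal k" and x: "x \<in> carrier R"
  then obtain b where b: "b \<in> carrier R" "a = [k] \<cdot> b" by blast
  then have "x \<otimes> a = [k] \<cdot> (x \<otimes> b)" "a \<otimes> x = [k] \<cdot> (b \<otimes> x)"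
    using x by (simp_all add: add_pow_rdistr add_pow_ldistr)
  then show "x \<otimes> a \<in> mult_ideal k" "a \<otimes> x \<in> mult_ideal k" using x b by blast+
qed auto

definition plus_multiples :: "nat \<Rightarrow> 'a set \<Rightarrow> 'a set" where
  "plus_multiples k H = {h \<oplus> [k] \<cdot> x | h x. h \<in> H \<and> x \<in> carrier R}"

lemma subrng_plus_multiples:
  assumes H: "subrng H R"
  shows "subrng (plus_multiples k H) R"
proof -
  have Ha: "additive_subgroup H R" "\<And>x y. x \<in> H \<Longrightarrow> y \<in> H \<Longrightarrow> x \<otimes> y \<in> H" using H by (auto simp: subrng_def)
  have HR: "H \<subseteq> carrier R" using Ha(1) by (rule additive_subgroup.a_subset)
  have "additive_subgroup (plus_multiples k H) R"
  proof (rule additive_subgroupI')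
    show "plus_multiples k H \<subseteq> carrier R" using HR unfolding plus_multiples_def by auto
    show "\<zero> \<in> plus_multiples k H"
      unfolding plus_multiples_def using additive_subgroup.zero_closed[OF Ha(1)]
      by (intro CollectI exI[of _ \<zero>]) simp
    fix u v assume "u \<in> plus_multiples k H" "v \<in> plus_multiples k H"
    then obtain a x b y where *: "a \<in> H" "x \<in> carrier R" "b \<in> H" "y \<in> carrier R"
      "u = a \<oplus> [k] \<cdot> x" "v = b \<oplus> [k] \<cdot> y" unfolding plus_multiples_def by blast
    have c: "a \<in> carrier R" "b \<in> carrier R" "[k] \<cdot> x \<in> carrier R" "[k] \<cdot> y \<in> carrier R" using * HR by auto
    then have "u \<ominus> v = (a \<ominus> b) \<oplus> ([k] \<cdot> x \<ominus> [k] \<cdot> y)" unfolding * by algebra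
    then have "u \<ominus> v = (a \<ominus> b) \<oplus> [k] \<cdot> (x \<ominus> y)" using * by (simp add: add_pow_diff)
    moreover have "a \<ominus> b \<in> H" using * diff_mem[OF Ha(1)] by blast
    moreover have "x \<ominus> y \<in> carrier R" using * by simp
    ultimately show "u \<ominus> v \<in> plus_multiples k H" unfolding plus_multiples_def by blast
  qed
  moreover have "u \<otimes> v \<in> plus_multiples k H"
    if uv: "u \<in> plus_multiples k H" "v \<in> plus_multiples k H" for u v
  proof -
    obtain a x b y where *: "a \<in> H" "x \<in> carrier R" "b \<in> H" "y \<in> carrier R"
      "u = a \<oplus> [k] \<cdot> x" "v = b \<oplus> [k] \<cdot> y" using uv unfolding plus_multiples_def by blast
    have c: "a \<in> carrier R" "b \<in> carrier R" "[k] \<cdot> y \<in> carrier R" using * HR by auto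
    \<comment> \<open>Every term of the expanded product other than \<open>a \<otimes> b\<close> is
      a multiple of \<open>k\<close>.\<close>
    then have "u \<otimes> v = a \<otimes> b \<oplus> (a \<otimes> ([k] \<cdot> y) \<oplus> ([k] \<cdot> x) \<otimes> (b \<oplus> [k] \<cdot> y))"
      unfolding * using *(2) by (simp add: l_distr r_distr a_ac)
    also have "a \<otimes> ([k] \<cdot> y) \<oplus> ([k] \<cdot> x) \<otimes> (b \<oplus> [k] \<cdot> y) = [k] \<cdot> (a \<otimes> y \<oplus> x \<otimes> (b \<oplus> [k] \<cdot> y))"
      using c *(2,4) by (simp add: add_pow_rdistr add_pow_ldistr add.nat_pow_distrib r_distr a_ac)
    finally have "u \<otimes> v = a \<otimes> b \<oplus> [k] \<cdot> (a \<otimes> y \<oplus> x \<otimes> (b \<oplus> [k] \<cdot> y))" .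
    moreover have "a \<otimes> b \<in> H" using * Ha(2) by blast
    moreover have "a \<otimes> y \<oplus> x \<otimes> (b \<oplus> [k] \<cdot> y) \<in> carrier R" using c *(2,4) by simp
    ultimately show ?thesis unfolding plus_multiples_def by blast
  qed
  ultimately show ?thesis unfolding subrng_def by blast
qed

lemma plus_multiples_superset:
  assumes "subrng H R"
  shows "H \<subseteq> plus_multiples k H" "mult_ideal k \<subseteq> plus_multiples k H"
proof -
  have H: "H \<subseteq> carrier R" "\<zero> \<in> H"
    using assms additive_subgroup.a_subset additive_subgroup.zero_closed unfolding subrng_def by blast+
  show "H \<subseteq> plus_multiples k H"
  proof
    fix h assume h: "h \<in> H"
    then have "h = h \<oplus> [k] \<cdot> \<zero>" using H(1) by auto
    then show "h \<in> plus_multiples k H" unfolding plus_multiples_def using h zero_closed by blast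
  qed
  show "mult_ideal k \<subseteq> plus_multiples k H"
  proof
    fix u assume "u \<in> mult_ideal k"
    then obtain x where x: "x \<in> carrier R" "u = [k] \<cdot> x" by blast
    then have "u = \<zero> \<oplus> [k] \<cdot> x" by simp
    then show "u \<in> plus_multiples k H" unfolding plus_multiples_def using H(2) x by blast
  qed
qed

text \<open>Substituting R = H + mR into R = H + kR gives R = H + kmR = H. Consequently a proper
  subring containing kmR stays proper after adding kR or after adding mR.\<close>

lemma plus_multiples_mult:
  assumes H: "additive_subgroup H R" and eq: "plus_multiples k H = carrier R" "plus_multiples m H = carrier R"
    and sub: "mult_ideal (k * m) \<subseteq> H"
  shows "H = carrier R"
proof
  show "carrier R \<subseteq> H"
  proof
    fix x assume "x \<in> carrier R"
    then have "x \<in> plus_multiples k H" using eq by simp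
    then obtain h y where hy: "h \<in> H" "y \<in> carrier R" "x = h \<oplus> [k] \<cdot> y" unfolding plus_multiples_def by blast
    then have "y \<in> plus_multiples m H" using eq by simp
    then obtain g z where gz: "g \<in> H" "z \<in> carrier R" "y = g \<oplus> [m] \<cdot> z" unfolding plus_multiples_def by blast
    have g: "g \<in> carrier R" using gz(1) H additive_subgroup.a_subset by blast
    have "[k] \<cdot> y = [k] \<cdot> g \<oplus> [(k * m)] \<cdot> z"
      using g gz by (simp add: add.nat_pow_distrib add.nat_pow_pow mult.commute)
    moreover have "[(k * m)] \<cdot> z \<in> H" using sub gz by blast
    moreover have "[k] \<cdot> g \<in> H" using add_pow_mem[OF H gz(1)] .
    ultimately show "x \<in> H" using hy additive_subgroup.a_closed[OF H] by simp
  qed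
qed (rule additive_subgroup.a_subset[OF H])

lemma covered_above_plus_multiples:
  assumes C: "finite C" "ring_cover C R" "C' \<subseteq> C" and proper: "\<forall>H\<in>C'. plus_multiples k H \<noteq> carrier R"
    and un: "carrier R \<subseteq> \<Union>(plus_multiples k ` C')"
  shows "covered_above R (mult_ideal k) (card C)"
proof -
  have sub: "subrng H R" if "H \<in> C'" for H using that C unfolding ring_cover_def by blast
  have "plus_multiples k H \<subseteq> carrier R" if "H \<in> C'" for H
    using subrng_plus_multiples[OF sub[OF that]] additive_subgroup.a_subset unfolding subrng_def by blast
  then have "ring_cover (plus_multiples k ` C') R"
    using un proper sub subrng_plus_multiples unfolding ring_cover_def by blast
  moreover have "finite C'" using C finite_subset by blast
  moreover have "card (plus_multiples k ` C') \<le> card C"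
    using C card_image_le[OF \<open>finite C'\<close>] card_mono[OF C(1,3)] order_trans by blast
  moreover have "\<forall>H\<in>plus_multiples k ` C'. mult_ideal k \<subseteq> H"
    using sub plus_multiples_superset(2) by blast
  ultimately show ?thesis unfolding covered_above_def by blast
qed

text \<open>Induction on \<open>N = p * m\<close> with \<open>p\<close> prime: either the proper
  enlargements by multiples of \<open>p\<close> cover the ring, or those by multiples of
  \<open>m\<close> do, and then the induction hypothesis applies to \<open>m\<close>.\<close>

lemma covered_above_prime_mult_ideal:
  assumes "N > 0" "covered_above R (mult_ideal N) n"
  obtains p where "prime p" "covered_above R (mult_ideal p) n"
proof -
  have "\<exists>p. prime p \<and> covered_above R (mult_ideal p) n"
    using assms
  proof (induction N rule: less_induct)
    case (less N)
    obtain C where C: "finite C" "card C \<le> n" "ring_cover C R" "\<forall>H\<in>C. mult_ideal N \<subseteq> H"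
      using less.prems unfolding covered_above_def by blast
    have sub: "subrng H R" "additive_subgroup H R" "H \<subseteq> carrier R" "H \<noteq> carrier R" if "H \<in> C" for H
      using that C(3) unfolding ring_cover_def subrng_def by auto
    have un: "\<Union>C = carrier R" using C(3) unfolding ring_cover_def by blast
    then obtain M where "M \<in> C" using zero_closed by blast
    have "N \<noteq> 1"
    proof
      assume "N = 1"
      then have "mult_ideal N = carrier R" by simp
      then show False using sub[OF \<open>M \<in> C\<close>] C(4) \<open>M \<in> C\<close> by blast
    qed
    then obtain p where p: "prime p" "p dvd N" using prime_factor_nat by blast
    then obtain m where m: "N = p * m" by blast
    then have "m > 0" "m < N" using less.prems(1) prime_gt_1_nat[OF p(1)] by auto
    define C1 where "C1 = {H \<in> C. plus_multiples p H \<noteq> carrier R}"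
    define C2 where "C2 = {H \<in> C. plus_multiples m H \<noteq> carrier R}"
    \<comment> \<open>By \<open>plus_multiples_mult\<close>, no member can be enlarged to the whole
      ring both by \<open>p\<close> and by \<open>m\<close>.\<close>
    have C12: "C = C1 \<union> C2"
      using plus_multiples_mult[of _ p m] sub C(4) unfolding C1_def C2_def m by blast
    show ?case
    proof (cases "carrier R \<subseteq> \<Union>(plus_multiples p ` C1)")
      case True
      then have "covered_above R (mult_ideal p) (card C)"
        using C(1,3) by (intro covered_above_plus_multiples[of C C1]) (auto simp: C1_def)
      then show ?thesis using p(1) C(2) unfolding covered_above_def using order_trans by blast
    next
      case False
      then obtain X where X: "X \<in> carrier R" "X \<notin> \<Union>(plus_multiples p ` C1)" by blast
      have "carrier R \<subseteq> \<Union>(plus_multiples m ` C2)"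
      proof (rule ccontr)
        assume "\<not> carrier R \<subseteq> \<Union>(plus_multiples m ` C2)"
        then obtain Y where Y: "Y \<in> carrier R" "Y \<notin> \<Union>(plus_multiples m ` C2)" by blast
        show False
        proof (cases "p dvd m")
          \<comment> \<open>Without coprimality the inclusion of mR in pR is used instead: a member
            containing \<open>Y\<close> has its \<open>m\<close>-enlargement equal to the whole
            ring, hence its \<open>p\<close>-enlargement too, and so it cannot avoid
            \<open>X\<close>.\<close>
          case True
          then obtain q where q: "m = p * q" by blast
          obtain H where H: "H \<in> C" "Y \<in> H" using un Y(1) by blast
          have "H \<notin> C2" using Y H plus_multiples_superset(1)[OF sub(1)[OF H(1)]] by blast
          then have "plus_multiples m H = carrier R" "H \<in> C1" using H C12 unfolding C2_def by blast+
          moreover have "plus_multiples m H \<subseteq> plus_multiples p H"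
          proof
            fix u assume "u \<in> plus_multiples m H"
            then obtain h x where hx: "h \<in> H" "x \<in> carrier R" "u = h \<oplus> [m] \<cdot> x"
              unfolding plus_multiples_def by blast
            then have "u = h \<oplus> [p] \<cdot> ([q] \<cdot> x)" by (simp add: add.nat_pow_pow q mult.commute)
            then show "u \<in> plus_multiples p H"
              unfolding plus_multiples_def using hx add.nat_pow_closed[OF hx(2), of q] by blast
          qed
          ultimately show False using X by blast
        next
          case False
          then have "gcd p m = 1" using p(1) prime_imp_coprime coprime_iff_gcd_eq_1 by blast
          moreover have "p \<noteq> 0" using p(1) by auto
          ultimately obtain a b where ab: "p * a = m * b + 1" using bezout_nat[of p m] by auto
          define u v where "u = [(m * b)] \<cdot> X" and "v = [(m * b)] \<cdot> Y"
          have uv: "u \<in> carrier R" "v \<in> carrier R" using X Y unfolding u_def v_def by auto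
          have pX: "[p] \<cdot> ([a] \<cdot> X) = u \<oplus> X" and pY: "[p] \<cdot> ([a] \<cdot> Y) = v \<oplus> Y"
            using X(1) Y(1) ab unfolding u_def v_def by (simp_all add: add.nat_pow_pow mult.commute[of a])
          have mX: "[m] \<cdot> ([b] \<cdot> X) = u" and mY: "[m] \<cdot> ([b] \<cdot> Y) = v"
            using X(1) Y(1) unfolding u_def v_def by (simp_all add: add.nat_pow_pow mult.commute[of b])
          \<comment> \<open>Since \<open>p * a = m * b + 1\<close>, this \<open>z\<close> is
            congruent to \<open>X\<close> modulo \<open>p\<close> and to \<open>Y\<close> modulo
            \<open>m\<close>. A member containing \<open>z\<close> lies in \<open>C1\<close> or
            \<open>C2\<close>, so its enlargement captures \<open>X\<close> or
            \<open>Y\<close>.\<close>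
          define z where "z = (v \<oplus> Y) \<ominus> u"
          have "z \<in> \<Union>C" using uv X Y un unfolding z_def by simp
          then obtain H where H: "H \<in> C" "z \<in> H" by blast
          have "X = z \<oplus> ((u \<oplus> X) \<ominus> (v \<oplus> Y))" "Y = z \<oplus> (u \<ominus> v)"
            using X(1) Y(1) uv unfolding z_def by algebra+
          moreover have "(u \<oplus> X) \<ominus> (v \<oplus> Y) = [p] \<cdot> ([a] \<cdot> X \<ominus> [a] \<cdot> Y)" "u \<ominus> v = [m] \<cdot> ([b] \<cdot> X \<ominus> [b] \<cdot> Y)"
            using X(1) Y(1) by (simp_all add: add_pow_diff pX pY mX mY)
          moreover have "[a] \<cdot> X \<ominus> [a] \<cdot> Y \<in> carrier R" "[b] \<cdot> X \<ominus> [b] \<cdot> Y \<in> carrier R"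
            using X(1) Y(1) by simp_all
          ultimately have "\<exists>x\<in>carrier R. X = z \<oplus> [p] \<cdot> x" "\<exists>x\<in>carrier R. Y = z \<oplus> [m] \<cdot> x"
            by metis+
          then have "X \<in> plus_multiples p H" "Y \<in> plus_multiples m H"
            unfolding plus_multiples_def using H(2) by blast+
          then show False using X(2) Y(2) H(1) C12 by blast
        qed
      qed
      then have "covered_above R (mult_ideal m) (card C)"
        using C(1,3) by (intro covered_above_plus_multiples[of C C2]) (auto simp: C2_def)
      then have "covered_above R (mult_ideal m) n"
        using C(2) unfolding covered_above_def using order_trans by blast
      then show ?thesis using less.IH[OF \<open>m < N\<close> \<open>m > 0\<close>] by blast
    qed
  qed
  then show ?thesis using that by blast
qed

end

section \<open>The rings in \<open>S n\<close>\<close>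

text \<open>The condition on quotients is moved into \<open>R\<close> itself, so that later
  arguments need not handle cosets.\<close>

lemma S_iff:
  "R \<in> S n \<longleftrightarrow> ring R \<and> covering_number R = enat n \<and>
     (\<forall>I. ideal I R \<and> I \<noteq> {\<zero>\<^bsub>R\<^esub>} \<longrightarrow> \<not> covered_above R I n)"
  unfolding S_def using covering_number_Quot_le_iff by (auto simp flip: not_le)

lemma S_D:
  assumes "R \<in> S n"
  shows "ring R" "covering_number R = enat n"
    "\<And>I. ideal I R \<Longrightarrow> I \<noteq> {\<zero>\<^bsub>R\<^esub>} \<Longrightarrow> \<not> covered_above R I n"
  using S_iff[THEN iffD1, OF assms] by simp_all

lemma covering_number_le_Quot:
  assumes "ideal I R"
  shows "covering_number R \<le> covering_number (R Quot I)"
proof (cases "covering_number (R Quot I)")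
  case (enat k)
  then have "covered_above R I k" using covering_number_Quot_le_iff[OF assms, of k] by simp
  moreover have "{\<zero>\<^bsub>R\<^esub>} \<subseteq> I"
    using additive_subgroup.zero_closed[OF ideal.axioms(1)[OF assms]] by simp
  ultimately have "covered_above R {\<zero>\<^bsub>R\<^esub>} k" by (rule covered_above_mono)
  then show ?thesis unfolding enat covering_number_le_iff .
next
  case infinity
  then show ?thesis by simp
qed

text \<open>The bounded-index ideal of \<open>cover_le_ideal_bounded_index\<close> must be zero by
  minimality, and the index of the zero ideal is the order of the ring.\<close>

lemma S_carrier_bound:
  assumes "R \<in> S n"
  shows "finite (carrier R)" "card (carrier R) \<le> ideal_index_bound (fact n)"
proof -
  note R = S_D[OF assms]
  interpret ring R by (rule R(1))
  obtain J where J: "ideal J R" "covered_above R J n"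
    "bounded_index R (carrier R) J (ideal_index_bound (fact n))"
    by (rule cover_le_ideal_bounded_index[OF R(2)])
  then have "J = {\<zero>\<^bsub>R\<^esub>}" using R(3) by blast
  then obtain A where A: "A \<subseteq> carrier R" "finite A" "card A \<le> ideal_index_bound (fact n)"
    "\<forall>x\<in>carrier R. \<exists>a\<in>A. x \<ominus>\<^bsub>R\<^esub> a = \<zero>\<^bsub>R\<^esub>"
    using J(3) unfolding bounded_index_def by auto
  have "x \<in> A" if x: "x \<in> carrier R" for x
  proof -
    obtain a where a: "a \<in> A" "x \<ominus>\<^bsub>R\<^esub> a = \<zero>\<^bsub>R\<^esub>" using A(4) x by blast
    have aR: "a \<in> carrier R" using a A by blast
    have "x = (x \<ominus>\<^bsub>R\<^esub> a) \<oplus>\<^bsub>R\<^esub> a" using x aR by algebra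
    then show ?thesis using a aR by simp
  qed
  then have "carrier R = A" using A(1) by blast
  then show "finite (carrier R)" "card (carrier R) \<le> ideal_index_bound (fact n)" using A by simp_all
qed

lemma S_characteristic:
  assumes "R \<in> S n"
  obtains p where "prime p" "p < n" "ring_characteristic R = p"
proof -
  note R = S_D[OF assms]
  interpret ring R by (rule R(1))
  have fin: "finite (carrier R)" using S_carrier_bound(1)[OF assms] .
  obtain C where C: "finite C" "card C = n" "ring_cover C R" "\<And>D. D \<subset> C \<Longrightarrow> \<Union>D \<noteq> carrier R"
    using minimal_cover[OF R(2)] by blast
  have sub: "additive_subgroup H R" if "H \<in> C" for H
    using that C(3) unfolding ring_cover_def subrng_def by blast
  \<comment> \<open>In a finite ring two multiples of the identity coincide; the difference
    \<open>N\<close> of their coefficients annihilates the ring.\<close>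
  have "\<not> inj (\<lambda>k::nat. [k] \<cdot>\<^bsub>R\<^esub> \<one>\<^bsub>R\<^esub>)"
  proof
    assume "inj (\<lambda>k::nat. [k] \<cdot>\<^bsub>R\<^esub> \<one>\<^bsub>R\<^esub>)"
    then have "infinite (range (\<lambda>k::nat. [k] \<cdot>\<^bsub>R\<^esub> \<one>\<^bsub>R\<^esub>))" by (rule range_inj_infinite)
    moreover have "range (\<lambda>k::nat. [k] \<cdot>\<^bsub>R\<^esub> \<one>\<^bsub>R\<^esub>) \<subseteq> carrier R" by auto
    ultimately show False using fin finite_subset by blast
  qed
  then obtain i j :: nat where ij: "i < j" "[i] \<cdot>\<^bsub>R\<^esub> \<one>\<^bsub>R\<^esub> = [j] \<cdot>\<^bsub>R\<^esub> \<one>\<^bsub>R\<^esub>"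
    unfolding inj_on_def by (metis linorder_neqE_nat)
  define N where "N = j - i"
  have "N > 0" using ij(1) by (simp add: N_def)
  have "[i] \<cdot>\<^bsub>R\<^esub> \<one>\<^bsub>R\<^esub> \<oplus>\<^bsub>R\<^esub> [N] \<cdot>\<^bsub>R\<^esub> \<one>\<^bsub>R\<^esub> = [i] \<cdot>\<^bsub>R\<^esub> \<one>\<^bsub>R\<^esub>"
    unfolding ij(2) using ij(1) add.nat_pow_mult[OF one_closed, of i N] ij(2) by (simp add: N_def)
  moreover have "b = (a \<oplus>\<^bsub>R\<^esub> b) \<ominus>\<^bsub>R\<^esub> a" "a \<ominus>\<^bsub>R\<^esub> a = \<zero>\<^bsub>R\<^esub>" if "a \<in> carrier R" "b \<in> carrier R" for a b
    using that by algebra+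
  ultimately have N: "[N] \<cdot>\<^bsub>R\<^esub> \<one>\<^bsub>R\<^esub> = \<zero>\<^bsub>R\<^esub>" by (metis add.nat_pow_closed one_closed)
  have "[N] \<cdot>\<^bsub>R\<^esub> x = \<zero>\<^bsub>R\<^esub>" if "x \<in> carrier R" for x
    using add_pow_ldistr[OF one_closed that, of N] N that by simp
  then have "mult_ideal N = {\<zero>\<^bsub>R\<^esub>}" using zero_closed by fastforce
  moreover have "covered_above R {\<zero>\<^bsub>R\<^esub>} n" using R(2) covering_number_le_iff[of R n] by simp
  ultimately obtain p where p: "prime p" "covered_above R (mult_ideal p) n"
    using covered_above_prime_mult_ideal[OF \<open>N > 0\<close>, of n] by metis
  \<comment> \<open>The ideal pR lies in every member of some cover by at most \<open>n\<close>
    proper subrings, so membership in \<open>S n\<close> forces it to vanish.\<close>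
  have zero: "[p] \<cdot>\<^bsub>R\<^esub> x = \<zero>\<^bsub>R\<^esub>" if "x \<in> carrier R" for x
    using R(3)[OF ideal_mult_ideal] p(2) that by blast
  have "p < card C"
  proof (rule irredundant_cover_card_gt[OF C(1,3,4)])
    fix H x and d :: nat
    assume H: "H \<in> C" and x: "x \<in> carrier R" and d: "0 < d" "d < p" and dx: "[d] \<cdot>\<^bsub>R\<^esub> x \<in> H"
    show "x \<in> H" by (rule mem_of_add_pow_mem[OF p(1) zero[OF x] d sub[OF H] dx x])
  qed
  \<comment> \<open>The zero ring has no cover: its only subring is not proper. This excludes
    characteristic 1, and \<open>p\<close> is then least because any smaller positive multiplier
    killing the identity could be cancelled.\<close>
  have one: "\<one>\<^bsub>R\<^esub> \<noteq> \<zero>\<^bsub>R\<^esub>"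
  proof
    assume "\<one>\<^bsub>R\<^esub> = \<zero>\<^bsub>R\<^esub>"
    then have triv: "carrier R = {\<zero>\<^bsub>R\<^esub>}" by (rule one_zeroD)
    obtain M where M: "M \<in> C" using C(3) zero_closed unfolding ring_cover_def by blast
    have "\<zero>\<^bsub>R\<^esub> \<in> M" using sub[OF M] by (rule additive_subgroup.zero_closed)
    moreover have "M \<subseteq> carrier R" using sub[OF M] by (rule additive_subgroup.a_subset)
    moreover have "M \<noteq> carrier R" using C(3) M unfolding ring_cover_def by blast
    ultimately show False unfolding triv by blast
  qed
  have "p \<le> k" if k: "k > 0 \<and> [k] \<cdot>\<^bsub>R\<^esub> \<one>\<^bsub>R\<^esub> = \<zero>\<^bsub>R\<^esub>" for k :: nat
  proof (rule ccontr)
    assume "\<not> p \<le> k"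
    then have "k < p" by simp
    have "[k] \<cdot>\<^bsub>R\<^esub> \<one>\<^bsub>R\<^esub> \<in> {\<zero>\<^bsub>R\<^esub>}" using k by blast
    with \<open>k < p\<close> k have "\<one>\<^bsub>R\<^esub> \<in> {\<zero>\<^bsub>R\<^esub>}"
      using mem_of_add_pow_mem[OF p(1) zero[OF one_closed] _ _ ideal.axioms(1)[OF zeroideal] _ one_closed]
      by blast
    then show False using one by simp
  qed
  moreover have "p > 0 \<and> [p] \<cdot>\<^bsub>R\<^esub> \<one>\<^bsub>R\<^esub> = \<zero>\<^bsub>R\<^esub>" using zero[OF one_closed] prime_gt_0_nat[OF p(1)] by blast
  ultimately have "(LEAST k::nat. k > 0 \<and> [k] \<cdot>\<^bsub>R\<^esub> \<one>\<^bsub>R\<^esub> = \<zero>\<^bsub>R\<^esub>) = p" "\<exists>k::nat. k > 0 \<and> [k] \<cdot>\<^bsub>R\<^esub> \<one>\<^bsub>R\<^esub> = \<zero>\<^bsub>R\<^esub>"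
    by (auto intro: Least_equality)
  then have "ring_characteristic R = p" unfolding ring_characteristic_def by (simp only: if_True)
  then show ?thesis using that p(1) \<open>p < card C\<close> C(2) by blast
qed

section \<open>Existence of quotients in \<open>S n\<close> and the covering number
  criterion\<close>

text \<open>Take \<open>I\<close> maximal among the ideals above \<open>J\<close> that still admit a
  cover by at most \<open>n\<close> members. Bounded index leaves only finitely many candidates, so
  a maximal one exists without Zorn's lemma.\<close>

lemma ex_quotient_in_S:
  assumes "ring T" "covering_number T = enat n"
  shows "\<exists>I. ideal I T \<and> T Quot I \<in> S n"
proof -
  interpret ring T by fact
  obtain J where J: "ideal J T" "covered_above T J n"
    "bounded_index T (carrier T) J (ideal_index_bound (fact n))"
    by (rule cover_le_ideal_bounded_index[OF assms(2)])
  define W where "W = {I. ideal I T \<and> J \<subseteq> I \<and> covered_above T I n}"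
  have "finite W" using finite_ideals_above_bounded_index[OF J(3,1)]
    by (rule finite_subset[rotated]) (auto simp: W_def)
  moreover have "J \<in> W" using J unfolding W_def by blast
  ultimately obtain I where I: "I \<in> W" and max: "\<And>K. K \<in> W \<Longrightarrow> I \<subseteq> K \<Longrightarrow> I = K"
    using finite_has_maximal[of W] by blast
  have II: "ideal I T" "J \<subseteq> I" "covered_above T I n" using I unfolding W_def by auto
  have "covering_number (T Quot I) \<le> enat n" using covering_number_Quot_le_iff[OF II(1)] II(3) by blast
  then have "covering_number (T Quot I) = enat n"
    using covering_number_le_Quot[OF II(1)] assms(2) by simp
  moreover have "\<not> covered_above (T Quot I) \<J> n"
    if \<J>: "ideal \<J> (T Quot I)" "\<J> \<noteq> {\<zero>\<^bsub>T Quot I\<^esub>}" for \<J>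
  proof
    assume cov: "covered_above (T Quot I) \<J> n"
    note hom = ideal.rcos_ring_hom_ring[OF II(1)]
    \<comment> \<open>A nonzero ideal of the quotient violating the condition would pull back to a
      member of \<open>W\<close> above \<open>I\<close>. Maximality makes it equal to
      \<open>I\<close>, so the ideal was zero after all.\<close>
    define K where "K = {x \<in> carrier T. I +>\<^bsub>T\<^esub> x \<in> \<J>}"
    have sub: "\<J> \<subseteq> carrier (T Quot I)" "\<zero>\<^bsub>T Quot I\<^esub> \<in> \<J>"
      using additive_subgroup.a_subset[OF ideal.axioms(1)[OF \<J>(1)]]
        additive_subgroup.zero_closed[OF ideal.axioms(1)[OF \<J>(1)]] by blast+
    have zero: "\<zero>\<^bsub>T Quot I\<^esub> = I" by (simp add: FactRing_def)
    have "ideal K T" unfolding K_def by (rule ring_hom_ring.ideal_vimage[OF hom \<J>(1)])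
    moreover have IK: "I \<subseteq> K"
    proof
      fix x assume x: "x \<in> I"
      then have "I +>\<^bsub>T\<^esub> x = I" by (rule a_rcos_zero[OF II(1)])
      then show "x \<in> K" using x sub(2) zero ideal.Icarr[OF II(1)] unfolding K_def by simp
    qed
    moreover have "covered_above T K n"
      unfolding K_def using covered_above_vimage_iff[OF hom FactRing_hom_surj sub(2,1)] cov by blast
    ultimately have "I = K" using II(2) max[of K] unfolding W_def by blast
    have "y = \<zero>\<^bsub>T Quot I\<^esub>" if y: "y \<in> \<J>" for y
    proof -
      obtain x where x: "x \<in> carrier T" "y = I +>\<^bsub>T\<^esub> x"
        using y sub(1) FactRing_hom_surj[of T I] by blast
      then have "x \<in> I" using y \<open>I = K\<close> unfolding K_def by blast
      then show ?thesis using x(2) a_rcos_zero[OF II(1)] zero by simp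
    qed
    then show False using \<J>(2) sub(2) by blast
  qed
  ultimately have "T Quot I \<in> S n" unfolding S_iff using ideal.quotient_is_ring[OF II(1)] by blast
  with II(1) show ?thesis by blast
qed

text \<open>For the reverse direction, a quotient in \<open>S n\<close> makes the covering number
  some finite \<open>m \<le> n\<close>. Then \<open>3 \<le> m\<close> and there is a quotient in
  \<open>S m\<close>, so the exclusion of smaller values leaves \<open>m = n\<close>.\<close>

lemma covering_number_eq_iff_quotients:
  assumes "ring T"
  shows "covering_number T = enat n \<longleftrightarrow>
    (\<exists>I. ideal I T \<and> T Quot I \<in> S n) \<and> \<not> (\<exists>m I. 3 \<le> m \<and> m < n \<and> ideal I T \<and> T Quot I \<in> S m)"
proof
  have le: "covering_number T \<le> enat m" if "ideal I T" "T Quot I \<in> S m" for m I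
    using covering_number_le_Quot[OF that(1)] S_D(2)[OF that(2)] by simp
  show "(\<exists>I. ideal I T \<and> T Quot I \<in> S n) \<and> \<not> (\<exists>m I. 3 \<le> m \<and> m < n \<and> ideal I T \<and> T Quot I \<in> S m)"
    if "covering_number T = enat n"
    using ex_quotient_in_S[OF assms that] le that by fastforce
  assume *: "(\<exists>I. ideal I T \<and> T Quot I \<in> S n) \<and> \<not> (\<exists>m I. 3 \<le> m \<and> m < n \<and> ideal I T \<and> T Quot I \<in> S m)"
  then have "covering_number T \<le> enat n" using le by blast
  then obtain m where m: "covering_number T = enat m" "m \<le> n" by (cases "covering_number T") auto
  moreover have "3 \<le> m" using ring.covering_number_ge_3[OF assms m(1)] .
  moreover have "\<exists>I. ideal I T \<and> T Quot I \<in> S m" using ex_quotient_in_S[OF assms m(1)] .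
  ultimately show "covering_number T = enat n" using * by (metis le_neq_implies_less)
qed

section \<open>Isomorphism classes\<close>

text \<open>An isomorphism is surjective with zero kernel, so covers transfer in both directions and
  nonzero ideals pull back to nonzero ideals. The two carriers may have different types.\<close>

lemma S_ring_iso:
  assumes R: "R \<in> S n" and Q: "ring Q" and "R \<simeq> Q"
  shows "Q \<in> S n"
proof -
  obtain h where h: "h \<in> ring_hom R Q" "bij_betw h (carrier R) (carrier Q)"
    using assms(3) unfolding is_ring_iso_def ring_iso_def by blast
  note R' = S_D[OF R]
  have hom: "ring_hom_ring R Q h" using h(1) R'(1) Q by (intro ring_hom_ringI2)
  interpret ring_hom_ring R Q h by (rule hom)
  have surj: "h ` carrier R = carrier Q" using h(2) by (rule bij_betw_imp_surj_on)
  have cov: "covered_above Q J k \<longleftrightarrow> covered_above R {x \<in> carrier R. h x \<in> J} k"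
    if "\<zero>\<^bsub>Q\<^esub> \<in> J" "J \<subseteq> carrier Q" for J k
    using that by (rule covered_above_vimage_iff[OF hom surj])
  have inj: "x = y" if "x \<in> carrier R" "y \<in> carrier R" "h x = h y" for x y
    using that h(2) unfolding bij_betw_def inj_on_def by blast
  have "{x \<in> carrier R. h x \<in> {\<zero>\<^bsub>Q\<^esub>}} = {\<zero>\<^bsub>R\<^esub>}"
    using inj[OF _ R.zero_closed] by auto
  then have "covering_number Q \<le> enat k \<longleftrightarrow> covering_number R \<le> enat k" for k
    using cov[of "{\<zero>\<^bsub>Q\<^esub>}" k] unfolding covering_number_le_iff by simp
  then have le: "covering_number Q \<le> enat k \<longleftrightarrow> n \<le> k" for k using R'(2) by simp
  then obtain m where m: "covering_number Q = enat m" by (cases "covering_number Q") (use le[of n] in auto)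
  have "covering_number Q = enat n" using le[of n] le[of m] m by simp
  moreover have "\<not> covered_above Q J n" if J: "ideal J Q" "J \<noteq> {\<zero>\<^bsub>Q\<^esub>}" for J
  proof
    assume c: "covered_above Q J n"
    have sub: "\<zero>\<^bsub>Q\<^esub> \<in> J" "J \<subseteq> carrier Q"
      using additive_subgroup.a_subset[OF ideal.axioms(1)[OF J(1)]]
        additive_subgroup.zero_closed[OF ideal.axioms(1)[OF J(1)]] by blast+
    obtain j where j: "j \<in> J" "j \<noteq> \<zero>\<^bsub>Q\<^esub>" using J(2) sub(1) by blast
    then obtain x where x: "x \<in> carrier R" "j = h x" using sub(2) surj by blast
    then have "x \<noteq> \<zero>\<^bsub>R\<^esub>" using j(2) hom_zero by blast
    with j(1) x have "{x \<in> carrier R. h x \<in> J} \<noteq> {\<zero>\<^bsub>R\<^esub>}" by blast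
    then show False using R'(3)[OF ideal_vimage[OF J(1)]] cov[OF sub] c by blast
  qed
  ultimately show ?thesis using Q unfolding S_iff by blast
qed

text \<open>The operation tables are restricted to the carrier, since a ring record is unconstrained
  elsewhere. Relabelling by naturals makes codes of different rings comparable.\<close>

definition ring_code ::
  "('a \<Rightarrow> nat) \<Rightarrow> ('a, 'b) ring_scheme \<Rightarrow> nat set \<times> (nat \<times> nat \<times> nat) set \<times> (nat \<times> nat \<times> nat) set \<times> nat"
  where "ring_code f R = (f ` carrier R,
    {(f x, f y, f (x \<oplus>\<^bsub>R\<^esub> y)) |x y. x \<in> carrier R \<and> y \<in> carrier R},
    {(f x, f y, f (x \<otimes>\<^bsub>R\<^esub> y)) |x y. x \<in> carrier R \<and> y \<in> carrier R}, f \<one>\<^bsub>R\<^esub>)"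

text \<open>Matching the elements with equal labels, by \<open>f\<close> followed by the inverse of
  \<open>g\<close>, is an isomorphism because the relabelled tables agree.\<close>

lemma ring_code_eq_imp_iso:
  assumes R: "ring R" "inj_on f (carrier R)" and Q: "ring Q" "inj_on g (carrier Q)"
    and eq: "ring_code f R = ring_code g Q"
  shows "R \<simeq> Q"
proof -
  interpret R: ring R by fact
  interpret Q: ring Q by fact
  define h where "h x = inv_into (carrier Q) g (f x)" for x
  have im: "f ` carrier R = g ` carrier Q" using eq unfolding ring_code_def by simp
  have h: "h x \<in> carrier Q" "g (h x) = f x" if "x \<in> carrier R" for x
    using that im unfolding h_def by (metis imageI inv_into_into, metis imageI f_inv_into_f)
  have hI: "h x = a" if "a \<in> carrier Q" "f x = g a" for x a
    using that Q(2) unfolding h_def by simp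
  have "bij_betw h (carrier R) (carrier Q)"
    unfolding bij_betw_def
  proof
    show "inj_on h (carrier R)" using h(2) R(2) unfolding inj_on_def by metis
    show "h ` carrier R = carrier Q"
    proof
      show "carrier Q \<subseteq> h ` carrier R"
      proof
        fix a assume a: "a \<in> carrier Q"
        then obtain x where "x \<in> carrier R" "f x = g a" using im by (metis imageE imageI)
        then show "a \<in> h ` carrier R" using hI[OF a] by blast
      qed
    qed (use h in blast)
  qed
  moreover have "h \<in> ring_hom R Q"
  proof (rule ring_hom_memI)
    show "h \<one>\<^bsub>R\<^esub> = \<one>\<^bsub>Q\<^esub>" using eq by (intro hI) (auto simp: ring_code_def)
    fix x y assume xy: "x \<in> carrier R" "y \<in> carrier R"
    have "(f x, f y, f (x \<oplus>\<^bsub>R\<^esub> y)) \<in> fst (snd (ring_code g Q))"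
      unfolding eq[symmetric] using xy by (auto simp: ring_code_def)
    then obtain a b where "a \<in> carrier Q" "b \<in> carrier Q" "f x = g a" "f y = g b" "f (x \<oplus>\<^bsub>R\<^esub> y) = g (a \<oplus>\<^bsub>Q\<^esub> b)"
      unfolding ring_code_def by auto
    then show "h (x \<oplus>\<^bsub>R\<^esub> y) = h x \<oplus>\<^bsub>Q\<^esub> h y" using hI by (metis Q.a_closed)
    have "(f x, f y, f (x \<otimes>\<^bsub>R\<^esub> y)) \<in> fst (snd (snd (ring_code g Q)))"
      unfolding eq[symmetric] using xy by (auto simp: ring_code_def)
    then obtain a b where "a \<in> carrier Q" "b \<in> carrier Q" "f x = g a" "f y = g b" "f (x \<otimes>\<^bsub>R\<^esub> y) = g (a \<otimes>\<^bsub>Q\<^esub> b)"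
      unfolding ring_code_def by auto
    then show "h (x \<otimes>\<^bsub>R\<^esub> y) = h x \<otimes>\<^bsub>Q\<^esub> h y" using hI by (metis Q.m_closed)
  qed (use h in blast)
  ultimately show ?thesis unfolding is_ring_iso_def ring_iso_def by blast
qed

lemma ring_iso_rel_Image_eq:
  assumes "ring R" "ring Q" "R \<simeq> Q"
  shows "ring_iso_rel `` {R} = ring_iso_rel `` {Q}"
  using assms ring_iso_trans ring_iso_sym unfolding ring_iso_rel_def by blast

text \<open>Labels below \<open>B\<close> allow only finitely many codes, and the code determines
  the isomorphism class, although \<open>X\<close> itself may contain infinitely many
  records.\<close>

lemma finite_ring_classes_bounded_card:
  assumes "\<And>R. R \<in> X \<Longrightarrow> ring R \<and> finite (carrier R) \<and> card (carrier R) \<le> B"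
  shows "finite (X // ring_iso_rel)"
proof -
  have "\<exists>f. inj_on f (carrier R) \<and> f ` carrier R \<subseteq> {..<B}" if R: "R \<in> X" for R
  proof -
    obtain f where "bij_betw f (carrier R) {0..<card (carrier R)}"
      using ex_bij_betw_finite_nat assms[OF R] by blast
    then have "inj_on f (carrier R)" "f ` carrier R = {0..<card (carrier R)}" unfolding bij_betw_def by blast+
    then show ?thesis using assms[OF R] by (intro exI[of _ f]) auto
  qed
  then obtain f where f: "\<And>R. R \<in> X \<Longrightarrow> inj_on (f R) (carrier R) \<and> f R ` carrier R \<subseteq> {..<B}" by metis
  define c where "c R = ring_code (f R) R" for R
  let ?T = "{..<B} \<times> {..<B} \<times> {..<B}"
  have "c ` X \<subseteq> Pow {..<B} \<times> Pow ?T \<times> Pow ?T \<times> {..<B}"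
  proof
    fix v assume "v \<in> c ` X"
    then obtain R where R: "R \<in> X" "v = c R" by blast
    interpret ring R using assms[OF R(1)] by blast
    have *: "f R x < B" if "x \<in> carrier R" for x using f[OF R(1)] that by blast
    show "v \<in> Pow {..<B} \<times> Pow ?T \<times> Pow ?T \<times> {..<B}"
      unfolding R(2) c_def ring_code_def using * by auto
  qed
  then have fin: "finite (c ` X)" by (rule finite_subset) simp
  \<comment> \<open>Sends a code to the class of some ring in \<open>X\<close> with that code, so
    the set of classes lies in the image of a finite set.\<close>
  define s where "s v = ring_iso_rel `` {inv_into X c v}" for v
  have "ring_iso_rel `` {R} = s (c R)" if R: "R \<in> X" for R
  proof -
    define Q where "Q = inv_into X c (c R)"
    have Q: "Q \<in> X" "c Q = c R"
      using R unfolding Q_def by (simp_all add: inv_into_into f_inv_into_f)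
    then have "R \<simeq> Q" using assms f R unfolding c_def by (intro ring_code_eq_imp_iso) auto
    then show ?thesis using ring_iso_rel_Image_eq assms Q R unfolding s_def Q_def by blast
  qed
  then have "X // ring_iso_rel \<subseteq> s ` c ` X" unfolding quotient_def by blast
  then show ?thesis using fin finite_subset by blast
qed

text \<open>This makes finiteness independent of the carrier type: rings in \<open>S n\<close> are
  finite, so relabelling by naturals represents each class over \<open>nat\<close>, where the number
  of classes is finite.\<close>

lemma S_ex_nat_ring:
  assumes "R \<in> S n"
  shows "\<exists>Q \<in> (S n :: nat ring set). R \<simeq> Q"
proof -
  obtain f :: "'a \<Rightarrow> nat" where f: "inj_on f (carrier R)"
    using finite_imp_inj_to_nat_seg[OF S_carrier_bound(1)[OF assms]] by blast
  have "R \<simeq> image_ring f R" using inj_imp_image_ring_iso[OF f] unfolding is_ring_iso_def by blast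
  moreover have "ring (image_ring f R)"
    using ring.inj_imp_image_ring_is_ring[OF S_D(1)[OF assms] f] .
  ultimately show ?thesis using S_ring_iso[OF assms] by blast
qed

theorem theorem1p1:
  fixes n :: nat
  assumes "n \<ge> 3"
  shows "(finite ((S n :: 'a ring set) // ring_iso_rel) \<and>
          (\<forall>R \<in> (S n :: 'a ring set). \<exists>Q \<in> (S n :: nat ring set). R \<simeq> Q)) \<and>
         (\<forall>R \<in> (S n :: 'a ring set).
            finite (carrier R) \<and> (\<exists>p. prime p \<and> p < n \<and> ring_characteristic R = p)) \<and>
         (\<forall>T :: 'a ring. ring T \<longrightarrow>
            (covering_number T = enat n \<longleftrightarrow>
               (\<exists>I. ideal I T \<and> T Quot I \<in> S n) \<and>
               \<not> (\<exists>m I. 3 \<le> m \<and> m < n \<and> ideal I T \<and> T Quot I \<in> S m)))"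
proof (intro conjI ballI allI impI)
  show "finite ((S n :: 'a ring set) // ring_iso_rel)"
    by (rule finite_ring_classes_bounded_card[where B = "ideal_index_bound (fact n)"])
      (simp add: S_carrier_bound S_D(1))
  fix R :: "'a ring" assume R: "R \<in> S n"
  show "\<exists>Q \<in> (S n :: nat ring set). R \<simeq> Q" using S_ex_nat_ring[OF R] .
  show "finite (carrier R)" using S_carrier_bound(1)[OF R] .
  show "\<exists>p. prime p \<and> p < n \<and> ring_characteristic R = p" using S_characteristic[OF R] by blast
qed (rule covering_number_eq_iff_quotients)

end
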